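(* A DFS blockchain equipped with both mechanisms $\mathtt{queue}$ (queue info) and $\mathtt{fail}$ cannot implement transaction monitors.
   Context: Blockchain model. A configuration is a pair $(\Sigma,\Delta)$: $\Sigma$ is a partial map from addresses to the storage ($st$) and balance of smart contracts, and $\Delta$ is a context with additional information (block number, time, etc.). An operation $o$ is a record with fields $dest$ (invoked address), $src$ (source address), $param$ (parameters) and $money$ (amount sent). A smart contract is a deterministic partial map $A:\Delta\times P\times S\times\mathbb{N}\rightharpoonup S\times[\mathcal{O}]$ taking context, parameters, current storage and balance to a new storage and a list of new operations; undefined means failure. A fixed partial map $\mathbb{G}$ assigns contracts to addresses. Executing $o$ from $(\Sigma,\Delta)$ succeeds iff the balance of $o.src$ is at least $o.money$ and $\mathbb{G}(o.dest)(\Delta,o.param,\Sigma(o.dest).st,\Sigma(o.dest).balance)=(st',ls)$ is defined; then $o.money$ is moved from $o.src$ to $o.dest$, the storage of $o.dest$ becomes $st'$, and the new operations $ls$ are emitted. A transaction starts with pending list $[o]$, $o$ an external operation, and repeatedly executes the head $o$ of the pending list $o::os$; in a DFS blockchain the new pending list is $ls \mathbin{+\!\!+} os$ (new operations are added at the beginning). If an operation fails, the transaction fails and the state is unchanged; if the pending list becomes empty, the transaction commits. Contracts have no access to the pending list or to information about the current transaction other than through their own storage and the mechanisms the blockchain is equipped with. Gas: there is always sufficient gas for finite executions, and a transaction whose execution never ends fails by gas exhaustion. Mechanisms. - $\mathtt{fail}$: each contract has a flag $\mathtt{fail}$, false by default, that can be assigned during the execution of the contract; at the end of the transaction the whole transaction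 fails if some contract has its flag set to true. - $\mathtt{queue}$: an instruction indicating whether there is no more interaction between smart contracts, i.e. returning true iff the only operations in the pending list are recurring operations. A recurring operation invokes a private function of a contract that can read and write its storage and that either terminates or injects itself again; it is specially qualified as recurring in the contract and the runtime system ensures it only generates operations to the same contract. Transaction monitors. A monitored smart contract is a contract $A$ together with a private monitor storage and four functions $A_{init},A_{begin},A_{end},A_{term}$, which cannot emit operations or modify the contract storage, but can fail, in which case the whole transaction fails. $A_{init}$ runs before the first invocation of $A$ in a transaction; it reads the storage and balance of $A$ and reads and writes the monitor storage. $A_{begin}$ runs before each operation executed in $A$, with the operation's arguments and the monitor storage, which it may modify. $A_{end}$ runs after each operation executed in $A$, with the operation's result (emitted operations and new storage) and the monitor storage, which it may modify. $A_{term}$ runs at the end of the transaction (when the pending list is empty) for each contract $A$ visited in the transaction; it reads the storage and balance of $A$ and the monitor storage, without modifying the latter. If none of these functions fails, the effect on the blockchain is the same as without monitors. Implementation. A blockchain equipped with given mechanisms implements transaction monitors iff it can write every monitored smart contract; i.e. for each monitored contract there is an unmonitored contract written using the given mechanisms (possibly with auxiliary storage fields and private methods) that can replace it, with the same transactions failing or committing and the same behaviour of the contract. *)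

theory Defs
  imports Main "HOL-Library.Monad_Syntax"
begin

section \<open>Operations, storage and DFS transactions\<close>

record ('a, 'p) operation =
  dest :: 'a
  src :: 'a
  param :: 'p
  money :: nat

record 's account =
  st :: 's
  balance :: nat

text \<open>
  External users also need a balance to issue operations, so they have entries in the
  map too; their storage is irrelevant.
\<close>

type_synonym ('a, 's) chain = "'a \<rightharpoonup> 's account"

definition settle ::
  "('a, 's) chain \<Rightarrow> ('a, 'p) operation \<Rightarrow> 's \<Rightarrow> ('a, 's) chain option" where
  "settle \<Sigma> x s = do {
     sender \<leftarrow> \<Sigma> (src x);
     if money x \<le> balance sender then do {
       let \<Sigma>' = \<Sigma>(src x \<mapsto> sender\<lparr>balance := balance sender - money x\<rparr>);
       receiver \<leftarrow> \<Sigma>' (dest x);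
       Some (\<Sigma>'(dest x \<mapsto> receiver\<lparr>st := s, balance := balance receiver + money x\<rparr>))
     } else None
   }"

text \<open>
  A transaction body, generic in how a single operation is executed: \<open>exec \<sigma> x xs\<close>
  executes the head \<open>x\<close> of the pending list \<open>x # xs\<close>.  Emitted operations go to the front of
  the pending list (DFS).  A failing operation makes the run stuck and a non-terminating
  execution has no (finite) derivation, so that both yield a failed transaction below.
\<close>

inductive dfs_run ::
  "('g \<Rightarrow> 'o \<Rightarrow> 'o list \<Rightarrow> ('g \<times> 'o list) option) \<Rightarrow> 'g \<Rightarrow> 'o list \<Rightarrow> 'g \<Rightarrow> bool"
  for exec where
  empty: "dfs_run exec \<sigma> [] \<sigma>"
| step: "exec \<sigma> x xs = Some (\<sigma>', ls) \<Longrightarrow> dfs_run exec \<sigma>' (ls @ xs) \<tau> \<Longrightarrow> dfs_run exec \<sigma> (x # xs) \<tau>"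

definition dfs_transaction ::
  "('g \<Rightarrow> 'o \<Rightarrow> 'o list \<Rightarrow> ('g \<times> 'o list) option) \<Rightarrow> ('g \<Rightarrow> bool) \<Rightarrow> 'g \<Rightarrow> 'o \<Rightarrow> 'g option" where
  "dfs_transaction exec final_check \<sigma> x =
     (if \<exists>\<tau>. dfs_run exec \<sigma> [x] \<tau> \<and> final_check \<tau>
      then Some (THE \<tau>. dfs_run exec \<sigma> [x] \<tau>) else None)"

text \<open>
  The observable outcome of a sequence of transactions: for each one, whether it commits,
  and the state after it.
\<close>

fun history :: "('t \<Rightarrow> 'g \<Rightarrow> 'g option) \<Rightarrow> 't list \<Rightarrow> 'g \<Rightarrow> (bool \<times> 'g) list" where
  "history tx [] \<sigma> = []"
| "history tx (t # ts) \<sigma> =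
     (case tx t \<sigma> of
        Some \<sigma>' \<Rightarrow> (True, \<sigma>') # history tx ts \<sigma>'
      | None \<Rightarrow> (False, \<sigma>) # history tx ts \<sigma>)"

section \<open>Contracts and monitored contracts\<close>

type_synonym ('a, 'c, 'p, 's) contract =
  "'c \<Rightarrow> 'p \<Rightarrow> 's \<Rightarrow> nat \<Rightarrow> ('s \<times> ('a, 'p) operation list) option"

text \<open>
  Failure of a monitor function is \<open>None\<close> (\<open>False\<close> for \<open>on_term\<close>).
  The arguments of \<open>on_begin\<close> other than the monitor storage are those of the contract itself.
\<close>

record ('a, 'c, 'p, 's, 'm) monitored =
  code :: "('a, 'c, 'p, 's) contract"
  on_init :: "'s \<Rightarrow> nat \<Rightarrow> 'm \<Rightarrow> 'm option"
  on_begin :: "'c \<Rightarrow> 'p \<Rightarrow> 's \<Rightarrow> nat \<Rightarrow> 'm \<Rightarrow> 'm option"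
  on_end :: "('a, 'p) operation list \<Rightarrow> 's \<Rightarrow> 'm \<Rightarrow> 'm option"
  on_term :: "'s \<Rightarrow> nat \<Rightarrow> 'm \<Rightarrow> bool"

definition unmonitored :: "('a, 'c, 'p, 's) contract \<Rightarrow> ('a, 'c, 'p, 's, 'm) monitored" where
  "unmonitored A = \<lparr>code = A, on_init = (\<lambda>_ _ m. Some m), on_begin = (\<lambda>_ _ _ _ m. Some m),
     on_end = (\<lambda>_ _ m. Some m), on_term = (\<lambda>_ _ _. True)\<rparr>"

text \<open>
  State inside a transaction: the chain, the monitor storage of each contract, and the
  contracts visited so far.  The runtime records the emitting contract as the source
  of every emitted operation, so that no contract can spend another one's money.
\<close>

definition monitored_exec ::
  "('a \<rightharpoonup> ('a, 'c, 'p, 's, 'm) monitored) \<Rightarrow> 'c \<Rightarrow>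
   ('a, 's) chain \<times> ('a \<Rightarrow> 'm) \<times> 'a set \<Rightarrow> ('a, 'p) operation \<Rightarrow> ('a, 'p) operation list \<Rightarrow>
   ((('a, 's) chain \<times> ('a \<Rightarrow> 'm) \<times> 'a set) \<times> ('a, 'p) operation list) option" where
  "monitored_exec G \<Delta> = (\<lambda>(\<Sigma>, \<mu>, visited) x xs. do {
     let d = dest x;
     M \<leftarrow> G d;
     acc \<leftarrow> \<Sigma> d;
     m1 \<leftarrow> (if d \<in> visited then Some (\<mu> d) else on_init M (st acc) (balance acc) (\<mu> d));
     m2 \<leftarrow> on_begin M \<Delta> (param x) (st acc) (balance acc) m1;
     (s, ls) \<leftarrow> code M \<Delta> (param x) (st acc) (balance acc);
     m3 \<leftarrow> on_end M ls s m2;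
     \<Sigma>' \<leftarrow> settle \<Sigma> x s;
     Some ((\<Sigma>', \<mu>(d := m3), insert d visited), map (\<lambda>y. y\<lparr>src := d\<rparr>) ls)
   })"

definition term_check ::
  "('a \<rightharpoonup> ('a, 'c, 'p, 's, 'm) monitored) \<Rightarrow> ('a, 's) chain \<times> ('a \<Rightarrow> 'm) \<times> 'a set \<Rightarrow> bool" where
  "term_check G = (\<lambda>(\<Sigma>, \<mu>, visited). \<forall>d\<in>visited. \<forall>M acc.
     G d = Some M \<longrightarrow> \<Sigma> d = Some acc \<longrightarrow> on_term M (st acc) (balance acc) (\<mu> d))"

text \<open>Monitor storage persists between transactions, and is rolled back by a failing one.\<close>

definition monitored_tx ::
  "('a \<rightharpoonup> ('a, 'c, 'p, 's, 'm) monitored) \<Rightarrow> 'c \<times> ('a, 'p) operation \<Rightarrow>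
   ('a, 's) chain \<times> ('a \<Rightarrow> 'm) \<Rightarrow> (('a, 's) chain \<times> ('a \<Rightarrow> 'm)) option" where
  "monitored_tx G = (\<lambda>(\<Delta>, x) (\<Sigma>, \<mu>).
     map_option (\<lambda>(\<Sigma>', \<mu>', _). (\<Sigma>', \<mu>'))
       (dfs_transaction (monitored_exec G \<Delta>) (term_check G) (\<Sigma>, \<mu>, {}) x))"

section \<open>Contracts using queue info and the fail flag\<close>

text \<open>
  An operation invokes the public interface of a contract, one of its ordinary private methods,
  or one of its private methods qualified as recurring.
\<close>

datatype ('p, 'q) call = Public 'p | Private 'q | Recurring 'q

definition is_recurring :: "('a, ('p, 'q) call) operation \<Rightarrow> bool" where
  "is_recurring x \<longleftrightarrow> (\<exists>q. param x = Recurring q)"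

text \<open>
  Each method additionally receives the value of \<open>queue\<close>, which inspects the operations still
  pending behind the one being executed, and the current value of the
  contract's \<open>fail\<close> flag (in this order), and returns the new value of the flag next to the new
  storage.  A contract that only assigns the flag is the special case of ignoring its current
  value.  The last result of a recurring method says whether it injects itself again.
\<close>

record ('a, 'c, 'p, 'q, 's) qf_contract =
  public_method :: "'c \<Rightarrow> 'p \<Rightarrow> 's \<Rightarrow> nat \<Rightarrow> bool \<Rightarrow> bool \<Rightarrow>
    ('s \<times> bool \<times> ('a, ('p, 'q) call) operation list) option"
  private_method :: "'c \<Rightarrow> 'q \<Rightarrow> 's \<Rightarrow> nat \<Rightarrow> bool \<Rightarrow> bool \<Rightarrow>
    ('s \<times> bool \<times> ('a, ('p, 'q) call) operation list) option"
  recurring_method :: "'c \<Rightarrow> 'q \<Rightarrow> 's \<Rightarrow> nat \<Rightarrow> bool \<Rightarrow> bool \<Rightarrow> ('s \<times> bool \<times> bool) option"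

definition invoke ::
  "('a, 'c, 'p, 'q, 's) qf_contract \<Rightarrow> 'c \<Rightarrow> ('a, ('p, 'q) call) operation \<Rightarrow> 's \<Rightarrow> nat \<Rightarrow> bool \<Rightarrow> bool \<Rightarrow>
   ('s \<times> bool \<times> ('a, ('p, 'q) call) operation list) option" where
  "invoke C \<Delta> x s b queue flag =
     (case param x of
        Public p \<Rightarrow> public_method C \<Delta> p s b queue flag
      | Private q \<Rightarrow> private_method C \<Delta> q s b queue flag
      | Recurring q \<Rightarrow> map_option (\<lambda>(s', flag', again). (s', flag', if again then [x] else []))
          (recurring_method C \<Delta> q s b queue flag))"

text \<open>Private methods, recurring or not, can only be called on the emitting contract itself.\<close>

definition emitted_by ::
  "'a \<Rightarrow> ('a, ('p, 'q) call) operation \<Rightarrow> ('a, ('p, 'q) call) operation" where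
  "emitted_by a y =
     (case param y of Public _ \<Rightarrow> y\<lparr>src := a\<rparr> | _ \<Rightarrow> y\<lparr>src := a, dest := a\<rparr>)"

text \<open>State inside a transaction: the chain and the \<open>fail\<close> flag of each contract.\<close>

definition qf_exec ::
  "('a \<rightharpoonup> ('a, 'c, 'p, 'q, 's) qf_contract) \<Rightarrow> 'c \<Rightarrow>
   ('a, 's) chain \<times> ('a \<Rightarrow> bool) \<Rightarrow> ('a, ('p, 'q) call) operation \<Rightarrow>
   ('a, ('p, 'q) call) operation list \<Rightarrow>
   ((('a, 's) chain \<times> ('a \<Rightarrow> bool)) \<times> ('a, ('p, 'q) call) operation list) option" where
  "qf_exec G \<Delta> = (\<lambda>(\<Sigma>, flags) x xs. do {
     let d = dest x;
     C \<leftarrow> G d;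
     acc \<leftarrow> \<Sigma> d;
     (s, flag, ls) \<leftarrow>
       invoke C \<Delta> x (st acc) (balance acc) (list_all is_recurring xs) (flags d);
     \<Sigma>' \<leftarrow> settle \<Sigma> x s;
     Some ((\<Sigma>', flags(d := flag)), map (emitted_by d) ls)
   })"

definition to_public :: "('a, 'p) operation \<Rightarrow> ('a, ('p, 'q) call) operation" where
  "to_public x = \<lparr>dest = dest x, src = src x, param = Public (param x), money = money x\<rparr>"

definition qf_tx ::
  "('a \<rightharpoonup> ('a, 'c, 'p, 'q, 's) qf_contract) \<Rightarrow> 'c \<times> ('a, 'p) operation \<Rightarrow>
   ('a, 's) chain \<Rightarrow> ('a, 's) chain option" where
  "qf_tx G = (\<lambda>(\<Delta>, x) \<Sigma>.
     map_option fst
       (dfs_transaction (qf_exec G \<Delta>) (\<lambda>(_, flags). \<forall>a. \<not> flags a) (\<Sigma>, \<lambda>_. False) (to_public x)))"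

section \<open>Replacing a monitored contract\<close>

text \<open>
  Storages on the chain with mechanisms are pairs of the contract storage and the auxiliary
  fields.  A plain contract runs there without touching the auxiliary fields or the flag.
\<close>

definition plain :: "('a, 'c, 'p, 's) contract \<Rightarrow> ('a, 'c, 'p, 'q, 's \<times> 'x) qf_contract" where
  "plain A = \<lparr>
     public_method = (\<lambda>\<Delta> p (s, aux) b _ flag.
       map_option (\<lambda>(s', ls). ((s', aux), flag, map to_public ls)) (A \<Delta> p s b)),
     private_method = (\<lambda>_ _ _ _ _ _. None),
     recurring_method = (\<lambda>_ _ _ _ _ _. None)\<rparr>"

definition erase :: "('a, 's \<times> 'x) chain \<Rightarrow> ('a, 's) chain" where
  "erase \<Sigma> = (\<lambda>a. map_option (\<lambda>acc. \<lparr>st = fst (st acc), balance = balance acc\<rparr>) (\<Sigma> a))"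

text \<open>
  \<open>U\<close> can replace \<open>M\<close> at address \<open>a\<close>: for all plain contracts \<open>E\<close> at the other addresses, all
  initial states (with the auxiliary fields of \<open>U\<close> initialised from the contract and monitor
  storage at deployment) and all sequences of transactions started by external users (not
  contracts), the same transactions commit and, auxiliary fields aside, the same chain results
  after each of them.  As \<open>E\<close> is arbitrary, the invocations made by the contract are observed
  through their effect on the other contracts.
\<close>

definition can_replace ::
  "'a \<Rightarrow> ('a, 'c, 'p, 'q, 's \<times> 'x) qf_contract \<Rightarrow> ('a, 'c, 'p, 's, 'm) monitored \<Rightarrow> bool" where
  "can_replace a U M \<longleftrightarrow> (\<exists>aux_init :: 's \<Rightarrow> 'm \<Rightarrow> 'x.
     \<forall>(E :: 'a \<rightharpoonup> ('a, 'c, 'p, 's) contract) \<Sigma> (\<mu> :: 'a \<Rightarrow> 'm) ts.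
       (\<forall>acc. \<Sigma> a = Some acc \<longrightarrow> snd (st acc) = aux_init (fst (st acc)) (\<mu> a)) \<longrightarrow>
       (\<forall>(\<Delta>, x) \<in> set ts. src x \<noteq> a \<and> E (src x) = None) \<longrightarrow>
       map (map_prod id erase)
         (history (qf_tx ((map_option plain \<circ> E)(a \<mapsto> U))) ts \<Sigma>) =
       map (map_prod id fst)
         (history (monitored_tx ((map_option unmonitored \<circ> E)(a \<mapsto> M))) ts (erase \<Sigma>, \<mu>)))"

end

theory Submission
  imports Defs
begin

text \<open>
  The idea is that a contract cannot recognise its first invocation in a transaction, so
  \<open>on_init\<close> cannot be simulated. Let \<open>on_init\<close> demand that the balance
  be zero (before the money of the invocation arrives), and suppose that \<open>U\<close> replaces
  this contract at \<open>a\<close>. In one transaction, \<open>b\<^sub>1\<close> invokes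
  \<open>a\<close> twice, sending one coin the first time; this has to commit. In another,
  \<open>b\<^sub>2\<close> invokes \<open>a\<close> with one coin and then an inert contract
  \<open>c\<close>; this has to commit as well. During the first invocation of \<open>a\<close>,
  with all its consequences, these runs differ only in the pending operation that comes
  afterwards, which in both cases is not recurring. So they reach the same state, in which all
  flags are false because the second transaction commits there. Hence an invocation of
  \<open>a\<close> in a new transaction after the second one continues exactly like the second
  invocation in the first one and commits, although \<open>a\<close> now owns a coin.
\<close>

section \<open>DFS runs\<close>

lemma dfs_run_Nil [simp]: "dfs_run exec \<sigma> [] \<tau> \<longleftrightarrow> \<tau> = \<sigma>"
  by (auto intro: dfs_run.empty elim: dfs_run.cases)

lemma dfs_run_Cons [simp]:
  "dfs_run exec \<sigma> (x # xs) \<tau> \<longleftrightarrow>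
     (\<exists>\<sigma>' ls. exec \<sigma> x xs = Some (\<sigma>', ls) \<and> dfs_run exec \<sigma>' (ls @ xs) \<tau>)"
  by (auto intro: dfs_run.step elim: dfs_run.cases)

lemma dfs_run_unique: "dfs_run exec \<sigma> xs \<tau> \<Longrightarrow> dfs_run exec \<sigma> xs \<tau>' \<Longrightarrow> \<tau>' = \<tau>"
  by (induction rule: dfs_run.induct) auto

lemma dfs_transaction_eq:
  assumes "dfs_run exec \<sigma> [x] \<tau>"
  shows "dfs_transaction exec final_check \<sigma> x = (if final_check \<tau> then Some \<tau> else None)"
proof -
  have "(THE \<tau>. dfs_run exec \<sigma> [x] \<tau>) = \<tau>"
    by (rule the_equality, rule assms) (rule dfs_run_unique[OF assms])
  then show ?thesis
    using assms dfs_run_unique[OF assms] unfolding dfs_transaction_def by (metis (full_types))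
qed

lemma dfs_transaction_eq_Some_iff:
  "dfs_transaction exec final_check \<sigma> x = Some \<tau> \<longleftrightarrow>
     dfs_run exec \<sigma> [x] \<tau> \<and> final_check \<tau>"
proof
  assume *: "dfs_transaction exec final_check \<sigma> x = Some \<tau>"
  then obtain \<tau>' where "dfs_run exec \<sigma> [x] \<tau>'"
    unfolding dfs_transaction_def by (auto split: if_splits)
  with * show "dfs_run exec \<sigma> [x] \<tau> \<and> final_check \<tau>"
    using dfs_transaction_eq[of exec \<sigma> x \<tau>' final_check] by (auto split: if_splits)
qed (auto simp: dfs_transaction_eq simp del: dfs_run_Cons)

text \<open>In DFS order \<open>ls\<close> and everything it emits are processed before
  \<open>zs\<close> is touched, so the run passes through a moment where exactly \<open>zs\<close>
  is pending. Since \<open>exec\<close> may inspect the pending list, the first half still shows it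
  \<open>zs\<close> at the end.\<close>

lemma dfs_run_append:
  assumes "dfs_run exec \<sigma> (ls @ zs) \<tau>"
  obtains \<rho> where "dfs_run (\<lambda>\<sigma> x xs. exec \<sigma> x (xs @ zs)) \<sigma> ls \<rho>" "dfs_run exec \<rho> zs \<tau>"
proof -
  have "\<exists>\<rho>. dfs_run (\<lambda>\<sigma> x xs. exec \<sigma> x (xs @ zs)) \<sigma> ls \<rho> \<and> dfs_run exec \<rho> zs \<tau>"
    using assms
  proof (induction \<sigma> "ls @ zs" \<tau> arbitrary: ls rule: dfs_run.induct)
    case (empty \<sigma>)
    then show ?case by simp
  next
    case (step \<sigma> x xs \<sigma>' ls' \<tau> ls)
    show ?case
    proof (cases ls)
      case Nil
      then show ?thesis using step.hyps by (auto simp flip: step.hyps(4))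
    next
      case (Cons y ys)
      then have eq: "y = x" "xs = ys @ zs" using step.hyps(4) by auto
      then have "ls' @ xs = (ls' @ ys) @ zs" by simp
      from step.hyps(3)[OF this] show ?thesis
        using step.hyps(1) by (auto simp: Cons eq)
    qed
  qed
  then show ?thesis using that by blast
qed

text \<open>Debiting zero leaves the sender's account unchanged, so the sender matters only through
  its existence.\<close>

lemma settle_no_money:
  assumes "money x = 0"
  shows "settle \<Sigma> x s =
    (if \<Sigma> (src x) = None then None
     else map_option (\<lambda>r. \<Sigma>(dest x \<mapsto> r\<lparr>st := s\<rparr>)) (\<Sigma> (dest x)))"
  using assms
  by (cases "\<Sigma> (dest x)") (auto simp: settle_def Let_def fun_upd_idem split: option.splits)

text \<open>Contract code never sees the source of an operation. This lets the user \<open>u\<close>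
  later stand in for \<open>b\<^sub>1\<close> as the caller of \<open>a\<close>.\<close>

lemma qf_exec_no_money_cong:
  assumes "money x = 0" "money y = 0" "dest x = dest y"
    and "param x = Public p" "param y = Public p"
    and "\<Sigma> (src x) \<noteq> None" "\<Sigma> (src y) \<noteq> None"
  shows "qf_exec G \<Delta> (\<Sigma>, flags) x xs = qf_exec G \<Delta> (\<Sigma>, flags) y xs"
proof -
  have "settle \<Sigma> x = settle \<Sigma> y"
    using assms by (auto simp: settle_no_money fun_eq_iff)
  then show ?thesis
    using assms by (simp add: qf_exec_def invoke_def)
qed

text \<open>The pending list is consulted only through \<open>queue\<close>, and one non-recurring
  operation in it makes \<open>queue\<close> false, whichever operation that is.\<close>

lemma qf_exec_nonrecurring_tail:
  assumes "\<not> is_recurring y" "\<not> is_recurring z"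
  shows "(\<lambda>\<sigma> x xs. qf_exec G \<Delta> \<sigma> x (xs @ [y])) = (\<lambda>\<sigma> x xs. qf_exec G \<Delta> \<sigma> x (xs @ [z]))"
  using assms by (auto simp: qf_exec_def fun_eq_iff)

section \<open>The monitor and its environment\<close>

definition zero_start :: "('a, 'c, 'p, 's, 'm) monitored" where
  "zero_start = (unmonitored (\<lambda>_ _ s _. Some (s, [])))
     \<lparr>on_init := \<lambda>_ b m. if b = 0 then Some m else None\<rparr>"

definition send :: "'a \<Rightarrow> nat \<Rightarrow> 'a \<Rightarrow> 'p \<Rightarrow> ('a, 'p) operation" where
  "send u n d p = \<lparr>dest = d, src = u, param = p, money = n\<rparr>"

lemma send_sel [simp]:
  "dest (send u n d p) = d" "src (send u n d p) = u"
  "param (send u n d p) = p" "money (send u n d p) = n"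
  by (simp_all add: send_def)

lemma send_update_src [simp]: "(send u n d p)\<lparr>src := v\<rparr> = send v n d p"
  by (simp add: send_def)

lemma to_public_send [simp]: "to_public (send u n d p) = send u n d (Public p)"
  by (simp add: to_public_def send_def)

lemma emitted_by_send [simp]: "emitted_by v (send u n d (Public p)) = send v n d (Public p)"
  by (simp add: emitted_by_def)

definition emitter :: "('a, 'p) operation list \<Rightarrow> ('a, 'c, 'p, 's) contract" where
  "emitter ls = (\<lambda>_ _ s _. Some (s, ls))"

text \<open>The call to \<open>c\<close> keeps a non-recurring operation pending while
  \<open>a\<close> runs; otherwise \<open>queue\<close> could tell the two transactions
  apart.\<close>

definition environment :: "'a \<Rightarrow> 'a \<Rightarrow> 'a \<Rightarrow> 'a \<Rightarrow> 'p \<Rightarrow> 'a \<rightharpoonup> ('a, 'c, 'p, 's) contract" where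
  "environment a b\<^sub>1 b\<^sub>2 c p =
     [b\<^sub>1 \<mapsto> emitter [send b\<^sub>1 1 a p, send b\<^sub>1 0 a p],
      b\<^sub>2 \<mapsto> emitter [send b\<^sub>2 1 a p, send b\<^sub>2 0 c p],
      c \<mapsto> emitter []]"

text \<open>With a single coin in the system and the same storage everywhere, a state is described
  by the owner of the coin.\<close>

definition one_coin :: "'a \<Rightarrow> 's \<Rightarrow> ('a, 's) chain" where
  "one_coin u s = (\<lambda>v. Some \<lparr>st = s, balance = if v = u then 1 else 0\<rparr>)"

lemma erase_one_coin: "erase (one_coin u s) = one_coin u (fst s)"
  by (simp add: erase_def one_coin_def fun_eq_iff)

section \<open>Single steps in the two execution models\<close>

lemma monitored_exec_unmonitored:
  assumes "G (dest x) = Some (unmonitored (emitter ls))" "\<Sigma> (dest x) = Some acc"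
  shows "monitored_exec G \<Delta> (\<Sigma>, \<mu>, V) x xs =
    map_option (\<lambda>\<Sigma>'. ((\<Sigma>', \<mu>, insert (dest x) V), map (\<lambda>y. y\<lparr>src := dest x\<rparr>) ls))
      (settle \<Sigma> x (st acc))"
  using assms
  by (auto simp: monitored_exec_def unmonitored_def emitter_def Let_def split: option.splits
      Option.bind_splits)

lemma monitored_exec_zero_start:
  assumes "G (dest x) = Some zero_start" "\<Sigma> (dest x) = Some acc"
  shows "monitored_exec G \<Delta> (\<Sigma>, \<mu>, V) x xs =
    (if dest x \<in> V \<or> balance acc = 0
     then map_option (\<lambda>\<Sigma>'. ((\<Sigma>', \<mu>, insert (dest x) V), [])) (settle \<Sigma> x (st acc))
     else None)"
  using assms
  by (auto simp: monitored_exec_def zero_start_def unmonitored_def Let_def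
      split: option.splits Option.bind_splits)

lemma settle_one_coin:
  assumes "u \<noteq> v"
  shows "settle (one_coin u s) (send u (Suc 0) v p) s = Some (one_coin v s)"
  using assms by (auto simp: settle_def one_coin_def Let_def fun_eq_iff)

text \<open>The right-hand side does not mention \<open>u\<close>: once the coin has arrived, the
  chain no longer reveals who paid it.\<close>

lemma settle_one_coin_update:
  assumes "u \<noteq> v"
  shows "settle (one_coin u s) (send u (Suc 0) v p) s' =
    Some ((one_coin v s)(v \<mapsto> \<lparr>st = s', balance = 1\<rparr>))"
  using assms by (auto simp: settle_def one_coin_def Let_def fun_eq_iff)

lemma settle_one_coin_no_money:
  "settle (one_coin u s) (send v 0 w p) s = Some (one_coin u s)"
  by (auto simp: settle_no_money one_coin_def fun_eq_iff)

lemma qf_exec_plain: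
  assumes "G (dest x) = Some (plain (emitter ls))" "\<Sigma> (dest x) = Some acc" "param x = Public p"
  shows "qf_exec G \<Delta> (\<Sigma>, flags) x xs =
    map_option (\<lambda>\<Sigma>'. ((\<Sigma>', flags), map (emitted_by (dest x) \<circ> to_public) ls))
      (settle \<Sigma> x (st acc))"
  using assms
  by (auto simp: qf_exec_def plain_def invoke_def emitter_def Let_def split: option.splits
      Option.bind_splits prod.splits)

text \<open>An inert contract writes back the storage it found, and no balance or flag
  changes.\<close>

lemma qf_exec_inert:
  assumes "G (dest x) = Some (plain (emitter []))" "param x = Public p" "money x = 0"
    and "qf_exec G \<Delta> (\<Sigma>, flags) x xs = Some (\<sigma>, ls)"
  shows "\<sigma> = (\<Sigma>, flags) \<and> ls = []"
proof -
  obtain acc where "\<Sigma> (dest x) = Some acc"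
    using assms(4) by (auto simp: qf_exec_def Let_def split: Option.bind_splits)
  with assms show ?thesis
    by (auto simp: qf_exec_plain settle_no_money fun_upd_idem split: if_splits)
qed

section \<open>The two routes to \<open>a\<close> and the direct call\<close>

locale counterexample =
  fixes a u b\<^sub>1 b\<^sub>2 c :: 'a and p :: 'p
  assumes distinct: "distinct [a, u, b\<^sub>1, b\<^sub>2, c]"
begin

abbreviation E :: "'a \<rightharpoonup> ('a, 'c, 'p, 's) contract" where
  "E \<equiv> environment a b\<^sub>1 b\<^sub>2 c p"

abbreviation monitored_env :: "'a \<rightharpoonup> ('a, 'c, 'p, 's, 'm) monitored" where
  "monitored_env \<equiv> (map_option unmonitored \<circ> E)(a \<mapsto> zero_start)"

lemma E_u: "E u = None"
  using distinct by (auto simp: environment_def)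

lemma monitored_env_simps:
  "monitored_env a = Some zero_start"
  "monitored_env b\<^sub>1 = Some (unmonitored (emitter [send b\<^sub>1 1 a p, send b\<^sub>1 0 a p]))"
  "monitored_env b\<^sub>2 = Some (unmonitored (emitter [send b\<^sub>2 1 a p, send b\<^sub>2 0 c p]))"
  "monitored_env c = Some (unmonitored (emitter []))"
  using distinct by (auto simp: environment_def)

lemma term_check_monitored_env: "term_check monitored_env \<tau>"
  by (auto simp: term_check_def unmonitored_def zero_start_def environment_def split: if_splits)

lemma distinct_sym:
  "a \<noteq> u" "u \<noteq> a" "a \<noteq> b\<^sub>1" "b\<^sub>1 \<noteq> a" "a \<noteq> b\<^sub>2" "b\<^sub>2 \<noteq> a" "a \<noteq> c" "c \<noteq> a"
  "u \<noteq> b\<^sub>1" "u \<noteq> b\<^sub>2" "b\<^sub>1 \<noteq> b\<^sub>2" "b\<^sub>2 \<noteq> b\<^sub>1" "b\<^sub>1 \<noteq> c" "b\<^sub>2 \<noteq> c"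
  using distinct by auto

lemma one_coin_at: "one_coin v s w = Some \<lparr>st = s, balance = if w = v then 1 else 0\<rparr>"
  by (simp add: one_coin_def)

lemmas monitored_run_simps = monitored_exec_zero_start monitored_exec_unmonitored one_coin_at
  settle_one_coin settle_one_coin_no_money distinct_sym monitored_env_simps

text \<open>The first call finds \<open>a\<close> without money, so \<open>on_init\<close> passes;
  at the second call \<open>a\<close> is already visited, so its coin does no harm.\<close>

lemma monitored_run_via_b\<^sub>1:
  "dfs_run (monitored_exec monitored_env \<Delta>) (one_coin u s, \<mu>, {}) [send u 1 b\<^sub>1 p]
     (one_coin a s, \<mu>, {a, b\<^sub>1})"
  by (simp add: monitored_run_simps del: fun_upd_apply)

lemma monitored_run_via_b\<^sub>2:
  "dfs_run (monitored_exec monitored_env \<Delta>) (one_coin u s, \<mu>, {}) [send u 1 b\<^sub>2 p]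
     (one_coin a s, \<mu>, {c, a, b\<^sub>2})"
  by (simp add: monitored_run_simps del: fun_upd_apply)

lemma monitored_tx_via_b\<^sub>1:
  "monitored_tx monitored_env (\<Delta>, send u 1 b\<^sub>1 p) (one_coin u s, \<mu>) = Some (one_coin a s, \<mu>)"
  unfolding monitored_tx_def
  by (simp add: dfs_transaction_eq[OF monitored_run_via_b\<^sub>1] term_check_monitored_env
      del: fun_upd_apply One_nat_def)

lemma monitored_tx_via_b\<^sub>2:
  "monitored_tx monitored_env (\<Delta>, send u 1 b\<^sub>2 p) (one_coin u s, \<mu>) = Some (one_coin a s, \<mu>)"
  unfolding monitored_tx_def
  by (simp add: dfs_transaction_eq[OF monitored_run_via_b\<^sub>2] term_check_monitored_env
      del: fun_upd_apply One_nat_def)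

text \<open>In a new transaction \<open>a\<close> is unvisited but owns the coin, so
  \<open>on_init\<close> fails.\<close>

lemma monitored_tx_direct:
  "monitored_tx monitored_env (\<Delta>, send u 0 a p) (one_coin a s, \<mu>) = None"
  by (simp add: monitored_tx_def dfs_transaction_def monitored_run_simps del: fun_upd_apply)

lemma qf_direct_commits:
  fixes U :: "('a, 'c, 'p, 'q, 's \<times> 'x) qf_contract" and s :: "'s \<times> 'x"
  defines "G \<equiv> (map_option plain \<circ> E)(a \<mapsto> U)"
  assumes tx1: "qf_tx G (\<Delta>, send u 1 b\<^sub>1 p) (one_coin u s) \<noteq> None"
    and tx2: "qf_tx G (\<Delta>, send u 1 b\<^sub>2 p) (one_coin u s) = Some \<Sigma>"
    and u: "\<Sigma> u \<noteq> None"
  shows "qf_tx G (\<Delta>, send u 0 a p) \<Sigma> \<noteq> None"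
proof -
  let ?exec = "qf_exec G \<Delta>" and ?ff = "\<lambda>_ :: 'a. False"
  let ?y = "send b\<^sub>1 0 a (Public p)" and ?z = "send b\<^sub>2 0 c (Public p)"
  have G: "G b\<^sub>1 = Some (plain (emitter [send b\<^sub>1 1 a p, send b\<^sub>1 0 a p]))"
    "G b\<^sub>2 = Some (plain (emitter [send b\<^sub>2 1 a p, send b\<^sub>2 0 c p]))"
    "G c = Some (plain (emitter []))" "G a = Some U"
    using distinct_sym by (auto simp: G_def environment_def)
  obtain \<tau>\<^sub>1 where run1: "dfs_run ?exec (one_coin u s, ?ff) [send u 1 b\<^sub>1 (Public p)] \<tau>\<^sub>1"
    and flags1: "\<forall>v. \<not> snd \<tau>\<^sub>1 v"
    using tx1 by (auto simp: qf_tx_def dfs_transaction_eq_Some_iff simp del: dfs_run_Cons)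
  obtain \<tau>\<^sub>2 where run2: "dfs_run ?exec (one_coin u s, ?ff) [send u 1 b\<^sub>2 (Public p)] \<tau>\<^sub>2"
    and flags2: "\<forall>v. \<not> snd \<tau>\<^sub>2 v" and \<tau>\<^sub>2: "fst \<tau>\<^sub>2 = \<Sigma>"
    using tx2 by (auto simp: qf_tx_def dfs_transaction_eq_Some_iff simp del: dfs_run_Cons)
  have run1': "dfs_run ?exec (one_coin b\<^sub>1 s, ?ff) [send b\<^sub>1 1 a (Public p), ?y] \<tau>\<^sub>1"
    using run1 by (simp add: qf_exec_plain G one_coin_at settle_one_coin distinct_sym)
  have run2': "dfs_run ?exec (one_coin b\<^sub>2 s, ?ff) [send b\<^sub>2 1 a (Public p), ?z] \<tau>\<^sub>2"
    using run2 by (simp add: qf_exec_plain G one_coin_at settle_one_coin distinct_sym)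
  \<comment> \<open>Here the two runs merge: \<open>U\<close> gets the same parameter, storage,
    balance, flag and \<open>queue\<close> value, and settlement forgets the payer.\<close>
  have "?exec (one_coin b\<^sub>1 s, ?ff) (send b\<^sub>1 1 a (Public p)) [?y] =
      ?exec (one_coin b\<^sub>2 s, ?ff) (send b\<^sub>2 1 a (Public p)) [?z]"
    by (simp add: qf_exec_def invoke_def is_recurring_def one_coin_at settle_one_coin_update
        distinct_sym)
  then obtain \<sigma> ls where runs: "dfs_run ?exec \<sigma> (ls @ [?y]) \<tau>\<^sub>1" "dfs_run ?exec \<sigma> (ls @ [?z]) \<tau>\<^sub>2"
    using run1' run2' by auto
  \<comment> \<open>\<open>\<rho>\<close> and \<open>\<rho>'\<close> are the states once the first
    call to \<open>a\<close> and all its consequences are done.\<close>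
  obtain \<rho> where \<rho>: "dfs_run (\<lambda>\<sigma> x xs. ?exec \<sigma> x (xs @ [?y])) \<sigma> ls \<rho>" "dfs_run ?exec \<rho> [?y] \<tau>\<^sub>1"
    using runs(1) by (rule dfs_run_append)
  obtain \<rho>' where \<rho>': "dfs_run (\<lambda>\<sigma> x xs. ?exec \<sigma> x (xs @ [?z])) \<sigma> ls \<rho>'" "dfs_run ?exec \<rho>' [?z] \<tau>\<^sub>2"
    using runs(2) by (rule dfs_run_append)
  have "(\<lambda>\<sigma> x xs. ?exec \<sigma> x (xs @ [?y])) = (\<lambda>\<sigma> x xs. ?exec \<sigma> x (xs @ [?z]))"
    by (rule qf_exec_nonrecurring_tail) (simp_all add: is_recurring_def)
  then have "\<rho>' = \<rho>"
    using dfs_run_unique \<rho>(1) \<rho>'(1) by metis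
  \<comment> \<open>Only the inert call to \<open>c\<close> is left, so the state is already the
    committed one.\<close>
  moreover have "\<rho>' = \<tau>\<^sub>2"
    using \<rho>'(2) qf_exec_inert[of G ?z p] G by (cases \<rho>') fastforce
  \<comment> \<open>Committing forces all flags to be false, as at the start of a fresh transaction
    on \<open>\<Sigma>\<close>.\<close>
  ultimately have \<rho>_eq: "\<rho> = (\<Sigma>, ?ff)"
    using \<tau>\<^sub>2 flags2 by (auto simp: prod_eq_iff)
  \<comment> \<open>The call \<open>?y\<close> succeeds from \<open>\<rho>\<close>, so its sender
    must have an account there.\<close>
  with \<rho>(2) have "\<Sigma> b\<^sub>1 \<noteq> None"
    by (auto simp: qf_exec_def settle_def split: Option.bind_splits)
  with u \<rho>(2) have "dfs_run ?exec (\<Sigma>, ?ff) [send u 0 a (Public p)] \<tau>\<^sub>1"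
    using qf_exec_no_money_cong[of "send u 0 a (Public p)" ?y p \<Sigma> G \<Delta> ?ff] by (simp add: \<rho>_eq)
  then show ?thesis
    using flags1 by (simp add: qf_tx_def dfs_transaction_eq case_prod_beta del: dfs_run_Cons)
qed

end

section \<open>Deriving the contradiction for an arbitrary candidate\<close>

lemma zero_start_not_replaceable:
  fixes a :: 'a and U :: "('a, 'c, 'p, 'q, 's \<times> 'x) qf_contract"
  assumes "infinite (UNIV :: 'a set) \<or> card (UNIV :: 'a set) \<ge> 5"
  shows "\<not> can_replace a U (zero_start :: ('a, 'c, 'p, 's, 'm) monitored)"
proof
  assume "can_replace a U (zero_start :: ('a, 'c, 'p, 's, 'm) monitored)"
  then obtain aux_init :: "'s \<Rightarrow> 'm \<Rightarrow> 'x" where same_history: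
    "\<And>(E :: 'a \<rightharpoonup> ('a, 'c, 'p, 's) contract) \<Sigma> (\<mu> :: 'a \<Rightarrow> 'm) ts.
      (\<forall>acc. \<Sigma> a = Some acc \<longrightarrow> snd (st acc) = aux_init (fst (st acc)) (\<mu> a)) \<Longrightarrow>
      (\<forall>(\<Delta>, x) \<in> set ts. src x \<noteq> a \<and> E (src x) = None) \<Longrightarrow>
      map (map_prod id erase) (history (qf_tx ((map_option plain \<circ> E)(a \<mapsto> U))) ts \<Sigma>) =
      map (map_prod id fst)
        (history (monitored_tx ((map_option unmonitored \<circ> E)(a \<mapsto> zero_start))) ts (erase \<Sigma>, \<mu>))"
    unfolding can_replace_def by blast
  \<comment> \<open>Five addresses leave at least four besides \<open>a\<close>, for
    \<open>u\<close>, \<open>b\<^sub>1\<close>, \<open>b\<^sub>2\<close> and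
    \<open>c\<close>.\<close>
  obtain T :: "'a set" where T: "finite T" "card T = 5"
    using assms by (meson infinite_arbitrarily_large obtain_subset_with_card_n)
  have "4 \<le> card (T - {a})"
    using T by (simp add: card_Diff_singleton_if)
  then obtain T' where "card T' = 4" "T' \<subseteq> T - {a}" "finite T'"
    using T by (meson obtain_subset_with_card_n)
  then obtain xs where xs: "distinct xs" "set xs = T'" "length xs = 4"
    using finite_distinct_list distinct_card by metis
  then obtain u b\<^sub>1 b\<^sub>2 c where "xs = [u, b\<^sub>1, b\<^sub>2, c]"
    by (auto simp: numeral_eq_Suc length_Suc_conv)
  then have "distinct [a, u, b\<^sub>1, b\<^sub>2, c]"
    using xs \<open>T' \<subseteq> T - {a}\<close> by auto
  then interpret counterexample a u b\<^sub>1 b\<^sub>2 c "undefined :: 'p"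
    by unfold_locales
  define \<mu> :: "'a \<Rightarrow> 'm" where "\<mu> = (\<lambda>_. undefined)"
  \<comment> \<open>The auxiliary part is the one \<open>aux_init\<close> prescribes at
    \<open>a\<close>, where the monitor storage is \<open>undefined\<close>.\<close>
  define s :: "'s \<times> 'x" where "s = (undefined, aux_init undefined undefined)"
  let ?\<Delta> = "undefined :: 'c" and ?p = "undefined :: 'p"
  let ?qf = "qf_tx ((map_option plain \<circ> E)(a \<mapsto> U))"
  have history_eq: "map (map_prod id erase) (history ?qf ts (one_coin u s)) =
      map (map_prod id fst) (history (monitored_tx monitored_env) ts (one_coin u (fst s), \<mu>))"
    if "\<forall>(\<Delta>, x) \<in> set ts. src x = u" for ts
    using same_history[of "one_coin u s" \<mu> ts E] that E_u distinct_sym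
    by (auto simp: one_coin_at erase_one_coin s_def \<mu>_def)
  have commits: "?qf (?\<Delta>, send u 1 b\<^sub>1 ?p) (one_coin u s) \<noteq> None"
    using history_eq[of "[(?\<Delta>, send u 1 b\<^sub>1 ?p)]"]
    by (auto simp: monitored_tx_via_b\<^sub>1 simp del: One_nat_def fun_upd_apply split: option.splits)
  \<comment> \<open>Both transactions must form one history: the auxiliary fields in
    \<open>\<Sigma>\<close> are whatever \<open>U\<close> left there, so \<open>\<Sigma>\<close>
    need not be an admissible initial state.\<close>
  obtain \<Sigma> where \<Sigma>: "?qf (?\<Delta>, send u 1 b\<^sub>2 ?p) (one_coin u s) = Some \<Sigma>"
    and \<Sigma>_erase: "erase \<Sigma> = one_coin a (fst s)"
    and fails: "?qf (?\<Delta>, send u 0 a ?p) \<Sigma> = None"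
    using history_eq[of "[(?\<Delta>, send u 1 b\<^sub>2 ?p), (?\<Delta>, send u 0 a ?p)]"]
    by (auto simp: monitored_tx_via_b\<^sub>2 monitored_tx_direct simp del: One_nat_def fun_upd_apply
        split: option.splits)
  have "erase \<Sigma> u \<noteq> None"
    by (simp add: \<Sigma>_erase one_coin_at)
  then have "\<Sigma> u \<noteq> None"
    by (simp add: erase_def)
  with commits \<Sigma> have "?qf (?\<Delta>, send u 0 a ?p) \<Sigma> \<noteq> None"
    by (rule qf_direct_commits)
  with fails show False by contradiction
qed

theorem lemma7:
  assumes "infinite (UNIV :: 'a set) \<or> card (UNIV :: 'a set) \<ge> 6"
  shows "\<not> (\<forall>(a :: 'a) (M :: ('a, 'c, 'p, 's, 'm) monitored).
            \<exists>U :: ('a, 'c, 'p, 'q, 's \<times> 'x) qf_contract. can_replace a U M)"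
proof -
  have "infinite (UNIV :: 'a set) \<or> card (UNIV :: 'a set) \<ge> 5"
    using assms by auto
  then have "\<not> can_replace a U (zero_start :: ('a, 'c, 'p, 's, 'm) monitored)"
    for a and U :: "('a, 'c, 'p, 'q, 's \<times> 'x) qf_contract"
    by (rule zero_start_not_replaceable)
  then show ?thesis by blast
qed

end
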